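(* Let $G$ be a finite digraph without loops that is star-shaped or inverse star-shaped. Then all reduced path homologies $\widetilde H_n(G)$ are trivial.
   Context: Fix a field $\mathbb K$. A finite digraph $G=(V,E)$ consists of a finite non-empty vertex set $V$ and $E\subset V\times V$; write $i\to j$ if $(i,j)\in E$. No loops: never $i\to i$ (two-way edges are permitted). $G$ is star-shaped if there is a vertex $a$ such that $a\to b$ for all $b\in V$, $b\ne a$; inverse star-shaped if there is a vertex $a$ such that $b\to a$ for all $b\ne a$. For $p\ge 0$, an elementary $p$-path is a sequence $i_0\dots i_p$ of vertices; it is regular if $i_{k-1}\ne i_k$ for all $k$. $\mathcal R_p$ is the $\mathbb K$-vector space with basis $\{e_{i_0\dots i_p}: i_0\dots i_p\text{ regular}\}$; $\mathcal R_{-1}=\mathbb K e$ with $e$ the empty path; $\mathcal R_{-2}=\{0\}$. The regular boundary operator $\partial:\mathcal R_p\to\mathcal R_{p-1}$ is $\partial e_{i_0\dots i_p}=\sum_{q=0}^p(-1)^qe_{i_0\dots\widehat{i_q}\dots i_p}$, with every term indexed by a non-regular sequence replaced by $0$ (so $\partial e_i=e$), and $\partial e=0$. An elementary path $i_0\dots i_p$ is allowed if $i_{k-1}\to i_k$ for all $k=1,\dots,p$. $\mathcal A_p$ is the span of $e_{i_0\dots i_p}$ over allowed $p$-paths, $\mathcal A_{-1}=\mathbb K e$, $\mathcal A_{-2}=\{0\}$, and $\Omega_p=\{v\in\mathcal A_p:\partial v\in\mathcal A_{p-1}\}$. The reduced path homologies $\widetilde H_n(G)$, $n\ge-1$, are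 the homologies of the chain complex $0\leftarrow\mathbb K=\Omega_{-1}\leftarrow\Omega_0\leftarrow\Omega_1\leftarrow\cdots$ with differential $\partial$. *)

theory Defs
  imports
    "Graph_Theory.Pair_Digraph"
    "HOL-Library.Poly_Mapping"
    "HOL-Algebra.Elementary_Groups"
begin

definition star_shaped :: "'v pair_pre_digraph \<Rightarrow> bool" where
  "star_shaped G \<longleftrightarrow> (\<exists>a\<in>pverts G. \<forall>b\<in>pverts G. b \<noteq> a \<longrightarrow> (a, b) \<in> parcs G)"

definition inverse_star_shaped :: "'v pair_pre_digraph \<Rightarrow> bool" where
  "inverse_star_shaped G \<longleftrightarrow> (\<exists>a\<in>pverts G. \<forall>b\<in>pverts G. b \<noteq> a \<longrightarrow> (b, a) \<in> parcs G)"

text \<open>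
  An elementary p-path is a list of p + 1 vertices; the empty list is the empty path, of
  degree -1. Degrees are integers, so there is no path of degree -2. A chain is a finitely
  supported function from lists to the field; e_x is \<open>Poly_Mapping.single x 1\<close>. The library's
  \<open>distinct_adj\<close> (consecutive entries are distinct) is regularity of paths.
\<close>

definition allowed_path :: "'v pair_pre_digraph \<Rightarrow> 'v list \<Rightarrow> bool" where
  "allowed_path G xs \<longleftrightarrow> set xs \<subseteq> pverts G \<and> successively (\<lambda>x y. (x, y) \<in> parcs G) xs"

text \<open>
  The linear extension of the regular boundary of elementary paths. It is written for all chains,
  but only its values on regular ones are relevant; allowed paths in a loopless digraph are regular.
  It maps \<open>single [i] 1\<close> to \<open>single [] 1\<close>, and \<open>single [] 1\<close> to 0 (an empty sum).
\<close>

definition boundary :: "('v list \<Rightarrow>\<^sub>0 'k::field) \<Rightarrow> ('v list \<Rightarrow>\<^sub>0 'k)" where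
  "boundary c =
    (\<Sum>xs\<in>Poly_Mapping.keys c. \<Sum>q<length xs.
       let ys = take q xs @ drop (Suc q) xs in
       if distinct_adj ys then Poly_Mapping.single ys ((-1) ^ q * Poly_Mapping.lookup c xs) else 0)"

definition allowed_chains :: "'v pair_pre_digraph \<Rightarrow> int \<Rightarrow> ('v list \<Rightarrow>\<^sub>0 'k::field) set" where
  "allowed_chains G p =
    {c. \<forall>xs\<in>Poly_Mapping.keys c. allowed_path G xs \<and> int (length xs) = p + 1}"

definition Omega :: "'v pair_pre_digraph \<Rightarrow> int \<Rightarrow> ('v list \<Rightarrow>\<^sub>0 'k::field) set" where
  "Omega G p = {v \<in> allowed_chains G p. boundary v \<in> allowed_chains G (p - 1)}"

definition path_cycles :: "'v pair_pre_digraph \<Rightarrow> int \<Rightarrow> ('v list \<Rightarrow>\<^sub>0 'k::field) set" where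
  "path_cycles G n = {v \<in> Omega G n. boundary v = 0}"

definition path_boundaries :: "'v pair_pre_digraph \<Rightarrow> int \<Rightarrow> ('v list \<Rightarrow>\<^sub>0 'k::field) set" where
  "path_boundaries G n = boundary ` Omega G (n + 1)"

text \<open>
  The quotient of cycles by boundaries, with its additive group structure. A vector space is
  trivial iff its additive group is, so the scalar action is not recorded.
\<close>

definition reduced_path_homology ::
  "'v pair_pre_digraph \<Rightarrow> int \<Rightarrow> ('v list \<Rightarrow>\<^sub>0 'k::field) set monoid" where
  "reduced_path_homology G n =
    \<lparr>carrier = path_cycles G n, mult = (+), one = 0\<rparr> Mod path_boundaries G n"

end

theory Submission
  imports Defs
begin

text \<open>
  A vertex \<open>a\<close> that sees every other vertex is the apex of a cone over the digraph. Prepending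
  \<open>a\<close> to a path turns allowed paths into allowed paths, except that a path that starts at \<open>a\<close>
  would become irregular and is sent to 0. The induced operator \<open>h\<close> on chains is a contracting
  homotopy: deleting the new first vertex returns the path, and deleting any other vertex commutes
  with the cone up to sign, so \<open>\<partial> h + h \<partial> = id\<close> on regular chains
  (\<open>left_cone_homotopy\<close>). If every vertex sees \<open>a\<close>, appending \<open>a\<close> does the same, once it is
  twisted by the sign of the degree (\<open>right_cone_homotopy\<close>).

  A cycle \<open>v\<close> is therefore the boundary of \<open>h v\<close>. Path homology demands in addition that \<open>h v\<close> lie
  in \<open>\<Omega>\<close>, and this costs nothing: \<open>h v\<close> is an allowed chain because \<open>v\<close> is, and its
  boundary is \<open>v\<close> itself, which is allowed (\<open>cycles_are_boundaries\<close>). When the subgroup by which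
  one divides contains the whole group of cycles, the quotient collapses to one coset.
\<close>

section \<open>Additive extension of maps on elementary paths\<close>

text \<open>
  The value at a path takes the coefficient as an argument, which gives linear extensions without
  a scalar action on chains: linearity only enters as additivity in the coefficient.
\<close>

definition additive_extension :: "('a \<Rightarrow> 'k \<Rightarrow> ('b \<Rightarrow>\<^sub>0 'k)) \<Rightarrow> ('a \<Rightarrow>\<^sub>0 'k) \<Rightarrow> ('b \<Rightarrow>\<^sub>0 'k::field)" where
  "additive_extension f c = (\<Sum>x\<in>Poly_Mapping.keys c. f x (Poly_Mapping.lookup c x))"

lemma additive_extension_superset:
  assumes "\<And>x. f x 0 = 0" "finite S" "Poly_Mapping.keys c \<subseteq> S"
  shows "additive_extension f c = (\<Sum>x\<in>S. f x (Poly_Mapping.lookup c x))"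
  unfolding additive_extension_def
  by (rule sum.mono_neutral_left) (use assms in \<open>auto simp: in_keys_iff\<close>)

lemma additive_extension_single:
  assumes "\<And>x. f x 0 = 0"
  shows "additive_extension f (Poly_Mapping.single x t) = f x t"
  using additive_extension_superset[of f "{x}" "Poly_Mapping.single x t"] assms by auto

lemma additive_extension_is_additive:
  fixes f :: "'a \<Rightarrow> 'k \<Rightarrow> ('b \<Rightarrow>\<^sub>0 'k::field)"
  assumes "\<And>x. additive (f x)"
  shows "additive (additive_extension f)"
proof
  fix c d :: "'a \<Rightarrow>\<^sub>0 'k"
  have zero: "f x 0 = 0" for x
    using assms additive.zero by blast
  \<comment> \<open>Cancellation can make the support of the sum smaller than the union of the supports.\<close>
  let ?S = "Poly_Mapping.keys c \<union> Poly_Mapping.keys d"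
  have "additive_extension f e = (\<Sum>x\<in>?S. f x (Poly_Mapping.lookup e x))"
    if "Poly_Mapping.keys e \<subseteq> ?S" for e :: "'a \<Rightarrow>\<^sub>0 'k"
    using additive_extension_superset[of f ?S e] zero that by simp
  then show "additive_extension f (c + d) = additive_extension f c + additive_extension f d"
    using Poly_Mapping.keys_add[of c d]
    by (simp add: lookup_add additive.add[OF assms] sum.distrib)
qed

lemma additive_eq_on_chain:
  assumes "additive F" "additive H"
    and "\<And>x t. x \<in> Poly_Mapping.keys c \<Longrightarrow>
           F (Poly_Mapping.single x t) = H (Poly_Mapping.single x t)"
  shows "F c = H c"
proof -
  have c: "c = (\<Sum>x\<in>Poly_Mapping.keys c. Poly_Mapping.single x (Poly_Mapping.lookup c x))"
    by (rule poly_mapping_eqI)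
      (simp add: lookup_sum lookup_single when_def in_keys_iff)
  show ?thesis
    by (subst (1 2) c) (simp add: additive.sum assms)
qed

section \<open>The regular boundary\<close>

definition face :: "nat \<Rightarrow> 'v list \<Rightarrow> 'v list" where
  "face q xs = take q xs @ drop (Suc q) xs"

definition path_boundary :: "'v list \<Rightarrow> 'k \<Rightarrow> ('v list \<Rightarrow>\<^sub>0 'k::field)" where
  "path_boundary xs t =
    (\<Sum>q<length xs. if distinct_adj (face q xs)
       then Poly_Mapping.single (face q xs) ((-1) ^ q * t) else 0)"

lemma boundary_eq_additive_extension: "boundary = additive_extension path_boundary"
  unfolding boundary_def additive_extension_def path_boundary_def face_def Let_def ..

lemma additive_path_boundary: "additive (path_boundary xs)"
  by standard (auto simp: path_boundary_def single_add distrib_left simp flip: sum.distrib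
      intro!: sum.cong)

lemma additive_boundary: "additive boundary"
  unfolding boundary_eq_additive_extension
  by (rule additive_extension_is_additive) (rule additive_path_boundary)

lemma boundary_single: "boundary (Poly_Mapping.single xs t) = path_boundary xs t"
  unfolding boundary_eq_additive_extension
  by (rule additive_extension_single) (rule additive.zero[OF additive_path_boundary])

lemma face_Cons_0 [simp]: "face 0 (x # xs) = xs"
  by (simp add: face_def)

lemma face_Cons_Suc [simp]: "face (Suc q) (x # xs) = x # face q xs"
  by (simp add: face_def)

lemma face_snoc_length [simp]: "face (length xs) (xs @ [x]) = xs"
  by (simp add: face_def)

lemma face_snoc [simp]: "q < length xs \<Longrightarrow> face q (xs @ [x]) = face q xs @ [x]"
  by (simp add: face_def)

lemma length_face: "q < length xs \<Longrightarrow> length (face q xs) = length xs - 1"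
  by (simp add: face_def)

lemma distinct_adj_snoc:
  "distinct_adj (xs @ [x]) \<longleftrightarrow> distinct_adj xs \<and> (xs = [] \<or> last xs \<noteq> x)"
  by (auto simp: distinct_adj_def successively_append_iff)

section \<open>Cones and their homotopies\<close>

definition left_cone_path :: "'v \<Rightarrow> 'v list \<Rightarrow> 'k \<Rightarrow> ('v list \<Rightarrow>\<^sub>0 'k::field)" where
  "left_cone_path a xs t =
    (if xs \<noteq> [] \<and> hd xs = a then 0 else Poly_Mapping.single (a # xs) t)"

text \<open>
  Deleting the appended vertex from a path of length \<open>m + 1\<close> carries the sign \<open>(-1) ^ m\<close>; the
  factor below cancels it, so that both cones satisfy the same homotopy formula.
\<close>

definition right_cone_path :: "'v \<Rightarrow> 'v list \<Rightarrow> 'k \<Rightarrow> ('v list \<Rightarrow>\<^sub>0 'k::field)" where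
  "right_cone_path a xs t =
    (if xs \<noteq> [] \<and> last xs = a then 0
     else Poly_Mapping.single (xs @ [a]) ((-1) ^ length xs * t))"

lemma additive_left_cone_path: "additive (left_cone_path a xs)"
  by standard (simp add: left_cone_path_def single_add)

lemma additive_right_cone_path: "additive (right_cone_path a xs)"
  by standard (simp add: right_cone_path_def single_add distrib_left)

lemma additive_extension_path_boundary:
  assumes "\<And>xs. additive (f xs)"
  shows "additive_extension f (path_boundary xs t) =
    (\<Sum>q<length xs. if distinct_adj (face q xs) then f (face q xs) ((-1) ^ q * t) else 0)"
proof -
  have add: "additive (additive_extension f)"
    by (rule additive_extension_is_additive) (rule assms)
  have "additive_extension f (if P then Poly_Mapping.single ys s else 0) = (if P then f ys s else 0)"
    for P ys s
    using additive_extension_single[of f ys s] additive.zero[OF assms] additive.zero[OF add] by simp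
  then show ?thesis
    by (simp add: path_boundary_def additive.sum[OF add])
qed

text \<open>
  For a path that does not start at \<open>a\<close>, the face of \<open>a # xs\<close> that omits \<open>a\<close> is \<open>xs\<close>, and the
  others are the cones of the faces of \<open>xs\<close> with the opposite sign. For a path that starts at \<open>a\<close>
  the cone vanishes, and \<open>xs\<close> is recovered from its boundary: only the face that omits the first
  vertex has a nonzero cone, which is \<open>xs\<close> again.
\<close>

lemma left_cone_path_homotopy:
  assumes "distinct_adj xs"
  shows "boundary (left_cone_path a xs t) + additive_extension (left_cone_path a) (path_boundary xs t)
    = Poly_Mapping.single xs t"
proof (cases "xs \<noteq> [] \<and> hd xs = a")
  case True
  then obtain ys where xs: "xs = a # ys"
    by (cases xs) auto
  have "distinct_adj ys" "ys = [] \<or> hd ys \<noteq> a"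
    using assms by (auto simp: xs distinct_adj_Cons)
  then have "additive_extension (left_cone_path a) (path_boundary xs t) = Poly_Mapping.single xs t"
    by (auto simp: additive_extension_path_boundary additive_left_cone_path xs sum.lessThan_Suc_shift
        left_cone_path_def simp del: sum.lessThan_Suc intro!: sum.neutral)
  then show ?thesis
    using True by (simp add: left_cone_path_def additive.zero[OF additive_boundary])
next
  case False
  have "boundary (left_cone_path a xs t) = path_boundary (a # xs) t"
    using False by (auto simp: left_cone_path_def boundary_single)
  also have "\<dots> = Poly_Mapping.single xs t +
      (\<Sum>q<length xs. if distinct_adj (a # face q xs)
         then Poly_Mapping.single (a # face q xs) (- ((-1) ^ q * t)) else 0)"
    using assms unfolding path_boundary_def
    by (simp add: sum.lessThan_Suc_shift del: sum.lessThan_Suc cong: if_cong)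
  also have "(\<Sum>q<length xs. if distinct_adj (a # face q xs)
         then Poly_Mapping.single (a # face q xs) (- ((-1) ^ q * t)) else 0)
      = - additive_extension (left_cone_path a) (path_boundary xs t)"
    unfolding additive_extension_path_boundary[OF additive_left_cone_path] sum_negf[symmetric]
    by (rule sum.cong) (auto simp: left_cone_path_def distinct_adj_Cons single_uminus)
  finally show ?thesis
    by simp
qed

text \<open>
  The mirror image of the previous argument. The face that yields \<open>xs\<close> is now the one that omits
  the last vertex, so its sign depends on the length of \<open>xs\<close> and meets the sign in the cone.
\<close>

lemma right_cone_path_homotopy:
  assumes "distinct_adj xs"
  shows "boundary (right_cone_path a xs t) + additive_extension (right_cone_path a) (path_boundary xs t)
    = Poly_Mapping.single xs t"
proof (cases "xs \<noteq> [] \<and> last xs = a")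
  case True
  then obtain ys where xs: "xs = ys @ [a]"
    by (metis append_butlast_last_id)
  have "distinct_adj ys" "ys = [] \<or> last ys \<noteq> a"
    using assms by (auto simp: xs distinct_adj_snoc)
  then have "additive_extension (right_cone_path a) (path_boundary xs t) = Poly_Mapping.single xs t"
    by (auto simp: additive_extension_path_boundary additive_right_cone_path xs
        right_cone_path_def simp flip: mult.assoc power_add intro!: sum.neutral)
  then show ?thesis
    using True by (simp add: right_cone_path_def additive.zero[OF additive_boundary])
next
  case False
  let ?s = "(-1) ^ length xs * t"
  have "boundary (right_cone_path a xs t) = path_boundary (xs @ [a]) ?s"
    using False by (auto simp: right_cone_path_def boundary_single)
  also have "\<dots> = (\<Sum>q<length xs. if distinct_adj (face q xs @ [a])
         then Poly_Mapping.single (face q xs @ [a]) ((-1) ^ q * ?s) else 0)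
       + Poly_Mapping.single xs t"
    using assms unfolding path_boundary_def
    by (simp cong: if_cong flip: mult.assoc power_add)
  also have "(\<Sum>q<length xs. if distinct_adj (face q xs @ [a])
         then Poly_Mapping.single (face q xs @ [a]) ((-1) ^ q * ?s) else 0)
      = - additive_extension (right_cone_path a) (path_boundary xs t)"
    unfolding additive_extension_path_boundary[OF additive_right_cone_path] sum_negf[symmetric]
  proof (rule sum.cong)
    fix q assume "q \<in> {..<length xs}"
    \<comment> \<open>A face is one vertex shorter than the path, which flips the sign built into the cone.\<close>
    then have "(-1) ^ q * ?s = - ((-1) ^ length (face q xs) * ((-1) ^ q * t))"
      by (cases xs) (auto simp: length_face)
    then show "(if distinct_adj (face q xs @ [a])
        then Poly_Mapping.single (face q xs @ [a]) ((-1) ^ q * ?s) else 0) =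
      - (if distinct_adj (face q xs)
         then right_cone_path a (face q xs) ((-1) ^ q * t) else 0)"
      by (auto simp: right_cone_path_def distinct_adj_snoc simp flip: single_uminus)
  qed simp
  finally show ?thesis
    by simp
qed

lemma cone_homotopy:
  assumes add: "\<And>xs. additive (f xs)"
    and hom: "\<And>xs t. distinct_adj xs \<Longrightarrow>
      boundary (f xs t) + additive_extension f (path_boundary xs t) = Poly_Mapping.single xs t"
    and reg: "\<And>xs. xs \<in> Poly_Mapping.keys c \<Longrightarrow> distinct_adj xs"
  shows "boundary (additive_extension f c) + additive_extension f (boundary c) = c"
proof -
  have ext: "additive (additive_extension f)"
    by (rule additive_extension_is_additive) (rule add)
  have "additive (\<lambda>c. boundary (additive_extension f c) + additive_extension f (boundary c))"
    by standard (simp add: additive.add[OF ext] additive.add[OF additive_boundary])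
  moreover have "additive (\<lambda>c. c)"
    by standard simp
  ultimately show ?thesis
    by (rule additive_eq_on_chain)
      (simp add: additive_extension_single additive.zero[OF add] boundary_single hom reg)
qed

lemmas left_cone_homotopy =
  cone_homotopy[OF additive_left_cone_path left_cone_path_homotopy]

lemmas right_cone_homotopy =
  cone_homotopy[OF additive_right_cone_path right_cone_path_homotopy]

section \<open>Cones of allowed chains\<close>

lemma allowed_path_regular:
  assumes "pair_digraph G" "allowed_path G xs"
  shows "distinct_adj xs"
proof -
  interpret pair_digraph G by fact
  have "x \<noteq> y" if "(x, y) \<in> parcs G" for x y
    using pair_no_loops[OF that] by simp
  then show ?thesis
    using assms(2) unfolding allowed_path_def distinct_adj_def
    by (auto intro: successively_mono)
qed

lemma left_cone_allowed:
  assumes "a \<in> pverts G" "\<forall>b\<in>pverts G. b \<noteq> a \<longrightarrow> (a, b) \<in> parcs G"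
    and "allowed_path G xs" "ys \<in> Poly_Mapping.keys (left_cone_path a xs t)"
  shows "allowed_path G ys \<and> length ys = Suc (length xs)"
  using assms
  by (cases xs) (auto simp: left_cone_path_def allowed_path_def successively_Cons split: if_splits)

lemma right_cone_allowed:
  assumes "a \<in> pverts G" "\<forall>b\<in>pverts G. b \<noteq> a \<longrightarrow> (b, a) \<in> parcs G"
    and "allowed_path G xs" "ys \<in> Poly_Mapping.keys (right_cone_path a xs t)"
  shows "allowed_path G ys \<and> length ys = Suc (length xs)"
  using assms
  by (cases xs rule: rev_cases)
    (auto simp: right_cone_path_def allowed_path_def successively_append_iff split: if_splits)

lemma additive_extension_allowed_chains:
  assumes "\<And>xs ys t. \<lbrakk>allowed_path G xs; ys \<in> Poly_Mapping.keys (f xs t)\<rbrakk>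
      \<Longrightarrow> allowed_path G ys \<and> length ys = Suc (length xs)"
    and "c \<in> allowed_chains G p"
  shows "additive_extension f c \<in> allowed_chains G (p + 1)"
  unfolding allowed_chains_def
proof (clarify)
  fix ys assume "ys \<in> Poly_Mapping.keys (additive_extension f c)"
  then obtain xs where "xs \<in> Poly_Mapping.keys c"
    and "ys \<in> Poly_Mapping.keys (f xs (Poly_Mapping.lookup c xs))"
    unfolding additive_extension_def using keys_sum by fastforce
  then show "allowed_path G ys \<and> int (length ys) = p + 1 + 1"
    using assms(1)[of xs ys] assms(2) by (fastforce simp: allowed_chains_def)
qed

section \<open>Vanishing of the homology\<close>

lemma cycles_are_boundaries:
  fixes G :: "'v pair_pre_digraph"
  assumes G: "pair_digraph G" and "star_shaped G \<or> inverse_star_shaped G"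
  shows "path_cycles G n \<subseteq> (path_boundaries G n :: ('v list \<Rightarrow>\<^sub>0 'k::field) set)"
proof
  fix v :: "'v list \<Rightarrow>\<^sub>0 'k"
  assume "v \<in> path_cycles G n"
  then have v: "v \<in> allowed_chains G n" and cyc: "boundary v = 0"
    by (auto simp: path_cycles_def Omega_def)
  have reg: "distinct_adj xs" if "xs \<in> Poly_Mapping.keys v" for xs
    using that v allowed_path_regular[OF G] by (auto simp: allowed_chains_def)
  obtain w where w: "w \<in> allowed_chains G (n + 1)" "boundary w = v"
    using assms(2)
  proof
    assume "star_shaped G"
    then obtain a where a: "a \<in> pverts G" "\<forall>b\<in>pverts G. b \<noteq> a \<longrightarrow> (a, b) \<in> parcs G"
      by (auto simp: star_shaped_def)
    have "additive_extension (left_cone_path a) v \<in> allowed_chains G (n + 1)"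
      by (rule additive_extension_allowed_chains[OF left_cone_allowed[OF a] v])
    moreover have "boundary (additive_extension (left_cone_path a) v) = v"
      using left_cone_homotopy[of v a] reg cyc by (simp add: additive_extension_def)
    ultimately show thesis by (rule that)
  next
    assume "inverse_star_shaped G"
    then obtain a where a: "a \<in> pverts G" "\<forall>b\<in>pverts G. b \<noteq> a \<longrightarrow> (b, a) \<in> parcs G"
      by (auto simp: inverse_star_shaped_def)
    have "additive_extension (right_cone_path a) v \<in> allowed_chains G (n + 1)"
      by (rule additive_extension_allowed_chains[OF right_cone_allowed[OF a] v])
    moreover have "boundary (additive_extension (right_cone_path a) v) = v"
      using right_cone_homotopy[of v a] reg cyc by (simp add: additive_extension_def)
    ultimately show thesis by (rule that)
  qed
  then have "w \<in> Omega G (n + 1)"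
    using v by (simp add: Omega_def)
  then show "v \<in> path_boundaries G n"
    using w(2) by (auto simp: path_boundaries_def)
qed

lemma allowed_chains_zero: "0 \<in> allowed_chains G p"
  by (simp add: allowed_chains_def)

lemma allowed_chains_diff:
  "\<lbrakk>c \<in> allowed_chains G p; d \<in> allowed_chains G p\<rbrakk> \<Longrightarrow> c - d \<in> allowed_chains G p"
  using keys_diff[of c d] by (auto simp: allowed_chains_def)

lemma path_boundaries_zero: "0 \<in> path_boundaries G n"
  unfolding path_boundaries_def Omega_def
  by (rule image_eqI[of _ _ 0]) (simp_all add: allowed_chains_zero additive.zero[OF additive_boundary])

lemma path_boundaries_diff:
  assumes "b \<in> path_boundaries G n" "c \<in> path_boundaries G n"
  shows "b - c \<in> path_boundaries G n"
proof -
  obtain v w where "v \<in> Omega G (n + 1)" "b = boundary v" "w \<in> Omega G (n + 1)" "c = boundary w"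
    using assms by (auto simp: path_boundaries_def)
  then have "v - w \<in> Omega G (n + 1)" "b - c = boundary (v - w)"
    by (auto simp: Omega_def allowed_chains_diff additive.diff[OF additive_boundary])
  then show ?thesis
    by (auto simp: path_boundaries_def)
qed

text \<open>
  Translating a subgroup by one of its own elements gives the subgroup back, so \<open>B\<close> is the only
  coset that \<open>Z\<close> produces.
\<close>

lemma trivial_quotient:
  fixes B Z :: "'a::ab_group_add set"
  assumes zero: "0 \<in> B" and diff: "\<And>b c. \<lbrakk>b \<in> B; c \<in> B\<rbrakk> \<Longrightarrow> b - c \<in> B"
    and Z: "0 \<in> Z" "Z \<subseteq> B"
  shows "trivial_group (\<lparr>carrier = Z, mult = (+), one = 0\<rparr> Mod B)" (is "trivial_group ?Q")
proof -
  have plus: "b + c \<in> B" if "b \<in> B" "c \<in> B" for b c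
    using diff[OF that(1) diff[OF zero that(2)]] by simp
  have coset: "(\<Union>b\<in>B. {b + z}) = B" if "z \<in> B" for z
  proof
    show "B \<subseteq> (\<Union>b\<in>B. {b + z})"
    proof
      fix b assume "b \<in> B"
      then have "b - z \<in> B" "b = (b - z) + z"
        using diff that by auto
      then show "b \<in> (\<Union>b\<in>B. {b + z})"
        by blast
    qed
  qed (use plus that in auto)
  have carrier: "carrier ?Q = {B}"
  proof -
    have "carrier ?Q = (\<lambda>z. \<Union>b\<in>B. {b + z}) ` Z"
      by (simp add: carrier_FactGroup r_coset_def)
    also have "\<dots> = (\<lambda>z. B) ` Z"
      using coset Z(2) by (intro image_cong) auto
    finally show ?thesis
      using Z(1) by auto
  qed
  have "(\<Union>b\<in>B. \<Union>c\<in>B. {b + c}) = (\<Union>c\<in>B. \<Union>b\<in>B. {b + c})"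
    by blast
  also have "\<dots> = B"
    using coset zero by auto
  finally have mult: "B \<otimes>\<^bsub>?Q\<^esub> B = B"
    by (simp add: set_mult_def)
  have "group ?Q"
    by (rule groupI) (simp_all add: carrier mult[simplified])
  then show ?thesis
    by (simp add: trivial_group_def carrier)
qed

theorem theorem4p6:
  fixes G :: "'v pair_pre_digraph" and n :: int
  assumes "pair_digraph G"
    and "pverts G \<noteq> {}"
    and "star_shaped G \<or> inverse_star_shaped G"
    and "n \<ge> -1"
  shows "trivial_group (reduced_path_homology G n :: ('v list \<Rightarrow>\<^sub>0 'k::field) set monoid)"
  unfolding reduced_path_homology_def
proof (rule trivial_quotient)
  show "0 \<in> path_cycles G n"
    by (simp add: path_cycles_def Omega_def allowed_chains_zero additive.zero[OF additive_boundary])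
  show "path_cycles G n \<subseteq> path_boundaries G n"
    using assms cycles_are_boundaries by blast
qed (simp_all add: path_boundaries_zero path_boundaries_diff)

end
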